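(* The standard polynomial $$s_k=\sum_{\pi\in S_k}\operatorname{sgn}(\pi)\,x_{\pi(1)}\cdots x_{\pi(k)}$$ is not a Lie polynomial, for any $k>2$.
   Context: $K$ denotes the ground field, $S_k$ is the symmetric group on $\{1,\dots,k\}$, and $s_k$ is regarded as an element of the free associative algebra over $K$ in the noncommuting letters $x_i$. A Lie polynomial is an element of the free Lie algebra over $K$ in the letters $x_i$, $i\in I$, i.e. a sum of scalar multiples of Lie words, where each letter is a Lie word and brackets of Lie words are Lie words. A Lie polynomial is identified with an element of the free associative algebra by interpreting the bracket as $[f,g]=fg-gf$.
   Formalization: The claim is proved for k>2 except k=2p^m (m≥1) when K has characteristic p>0; in those cases s_k is a Lie polynomial (e.g. s_4 in characteristic 2), so the claim fails there. In characteristic 0 nothing is excluded. *)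

theory Defs
  imports Complex_Main "HOL-Library.Poly_Mapping" "HOL-Combinatorics.Permutations"
begin

text \<open>
  The free associative unital algebra over a field on letters of type \<open>'i\<close> is the monoid
  algebra of the free monoid of words, i.e. of lists under concatenation. With lists as an
  (additively written) monoid, the convolution product of \<^theory>\<open>HOL-Library.Poly_Mapping\<close>
  on \<open>'i list \<Rightarrow>\<^sub>0 'a\<close> is exactly the product of noncommutative polynomials.
\<close>

instantiation list :: (type) monoid_add
begin

definition zero_list :: "'a list"
  where "zero_list = []"

definition plus_list :: "'a list \<Rightarrow> 'a list \<Rightarrow> 'a list"
  where "plus_list u v = u @ v"

instance
  by standard (simp_all add: zero_list_def plus_list_def)

end

type_synonym ('i, 'a) free_algebra = "'i list \<Rightarrow>\<^sub>0 'a"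

definition letter :: "'i \<Rightarrow> ('i, 'a::field) free_algebra"
  where "letter i = Poly_Mapping.single [i] 1"

definition scale :: "'a::field \<Rightarrow> ('i, 'a) free_algebra \<Rightarrow> ('i, 'a) free_algebra"
  where "scale c f = Poly_Mapping.single [] c * f"

global_interpretation free_algebra: vector_space scale
proof
  fix a b :: 'a and x y :: "('i, 'a) free_algebra"
  show "scale a (x + y) = scale a x + scale a y"
    by (simp add: scale_def distrib_left)
  show "scale (a + b) x = scale a x + scale b x"
    by (simp add: scale_def single_add distrib_right)
  show "scale a (scale b x) = scale (a * b) x"
    by (simp add: scale_def mult.assoc [symmetric] mult_single plus_list_def)
  show "scale 1 x = x"
    using single_one [where ?'a = "'i list" and ?'b = 'a] by (simp add: scale_def zero_list_def)
qed

text \<open>Lie words and Lie polynomials, as elements of the free associative algebra.\<close>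

definition bracket :: "('i, 'a::field) free_algebra \<Rightarrow> ('i, 'a) free_algebra \<Rightarrow> ('i, 'a) free_algebra"
  where "bracket f g = f * g - g * f"

inductive_set lie_words :: "'i set \<Rightarrow> ('i, 'a::field) free_algebra set"
  for I :: "'i set"
where
  letter: "i \<in> I \<Longrightarrow> letter i \<in> lie_words I"
| bracket: "f \<in> lie_words I \<Longrightarrow> g \<in> lie_words I \<Longrightarrow> bracket f g \<in> lie_words I"

definition lie_polynomial :: "'i set \<Rightarrow> ('i, 'a::field) free_algebra \<Rightarrow> bool"
  where "lie_polynomial I f \<longleftrightarrow> f \<in> free_algebra.span (lie_words I)"

text \<open>
  Over a field of characteristic \<open>p > 0\<close>, the polynomial \<open>s\<^sub>k\<close> with \<open>k = 2 * p ^ m\<close>, \<open>m \<ge> 1\<close>, is a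
  Lie polynomial; e.g. \<open>s\<^sub>4 = [[x\<^sub>1,x\<^sub>2],[x\<^sub>3,x\<^sub>4]] + [[x\<^sub>1,x\<^sub>3],[x\<^sub>2,x\<^sub>4]] + [[x\<^sub>1,x\<^sub>4],[x\<^sub>2,x\<^sub>3]]\<close> in
  characteristic 2. The condition \<open>k \<noteq> 2 * CHAR('a) ^ m\<close> for all \<open>m\<close> excludes exactly these
  degrees (given \<open>k > 2\<close>) and is vacuous in characteristic 0, where \<open>CHAR('a) = 0\<close>.

  The numbers \<open>1, \<dots>, k\<close> are embedded into the index type of the letters by \<open>\<iota>\<close>.
\<close>

definition standard_polynomial :: "(nat \<Rightarrow> 'i) \<Rightarrow> nat \<Rightarrow> ('i, 'a::field) free_algebra"
  where "standard_polynomial \<iota> k =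
    (\<Sum>\<pi> | \<pi> permutes {1..k}. scale (of_int (sign \<pi>)) (\<Prod>j\<leftarrow>[1..<Suc k]. letter (\<iota> (\<pi> j))))"

end

theory Submission
  imports Defs "HOL-Library.Product_Plus" "HOL-Algebra.Exponent"
begin

text \<open>
  Split the letters into two classes and let letters of different classes commute, so that a word
  becomes the pair of its restrictions to the classes. A bracket of elements living on different
  sides then vanishes, hence the image of a Lie polynomial has no coefficient at a pair of nonempty
  words; this is the easy half of Ree's criterion on shuffles. For \<open>s\<^sub>k\<close>, with the first \<open>j\<close> letters
  in one class, the coefficient at \<open>(x\<^sub>1\<dots>x\<^sub>j, x\<^sub>j\<^sub>+\<^sub>1\<dots>x\<^sub>k)\<close> is the signed number of shuffles of the
  two words, i.e. the Gaussian binomial coefficient of \<open>k\<close> over \<open>j\<close> at \<open>q = -1\<close>. It equals \<open>1\<close> for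
  odd \<open>k\<close> and \<open>j = 1\<close>, and the ordinary binomial coefficient of \<open>n\<close> over \<open>i\<close> for \<open>k = 2n\<close>, \<open>j = 2i\<close>;
  unless \<open>n\<close> is a power of the characteristic \<open>p\<close>, the latter is nonzero in the field for \<open>i = 1\<close>
  (\<open>p = 0\<close>) or for \<open>i\<close> the largest power of \<open>p\<close> dividing \<open>n\<close>.
\<close>

section \<open>Pushing forward along a homomorphism of monoids\<close>

text \<open>The linear map of monoid algebras induced by \<open>h\<close>: coefficients over each
  fibre of \<open>h\<close> are added up. Summing over the support keeps the sum finite even if
  fibres are infinite.\<close>

definition push :: "('m \<Rightarrow> 'n) \<Rightarrow> ('m \<Rightarrow>\<^sub>0 'a::comm_monoid_add) \<Rightarrow> 'n \<Rightarrow>\<^sub>0 'a"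
  where "push h f = (\<Sum>w\<in>Poly_Mapping.keys f. Poly_Mapping.single (h w) (Poly_Mapping.lookup f w))"

lemma push_superset:
  assumes "finite S" "Poly_Mapping.keys f \<subseteq> S"
  shows "push h f = (\<Sum>w\<in>S. Poly_Mapping.single (h w) (Poly_Mapping.lookup f w))"
  unfolding push_def
  by (rule sum.mono_neutral_left) (use assms in \<open>auto simp: in_keys_iff\<close>)

lemma push_zero [simp]: "push h 0 = 0"
  by (simp add: push_def)

lemma push_single [simp]: "push h (Poly_Mapping.single w c) = Poly_Mapping.single (h w) c"
  by (subst push_superset [of "{w}"]) auto

lemma push_add: "push h (f + g) = push h f + push h g"
proof -
  let ?S = "Poly_Mapping.keys f \<union> Poly_Mapping.keys g"
  have "Poly_Mapping.keys (f + g) \<subseteq> ?S"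
    by (rule keys_add)
  then show ?thesis
    by (simp add: push_superset [of ?S] lookup_add single_add sum.distrib)
qed

lemma push_sum: "push h (sum f S) = (\<Sum>x\<in>S. push h (f x))"
  by (induction S rule: infinite_finite_induct) (simp_all add: push_add)

lemma push_diff:
  fixes f :: "'m \<Rightarrow>\<^sub>0 'a::ab_group_add"
  shows "push h (f - g) = push h f - push h g"
  using push_add [of h "f - g" g] by simp

lemma poly_mapping_eq_sum_singles:
  fixes f :: "'m \<Rightarrow>\<^sub>0 'a::comm_monoid_add"
  shows "f = (\<Sum>w\<in>Poly_Mapping.keys f. Poly_Mapping.single w (Poly_Mapping.lookup f w))"
  by (rule poly_mapping_eqI)
    (auto simp: lookup_sum lookup_single when_def in_keys_iff sum.delta' intro!: sum.neutral)

text \<open>Expanding both factors into monomials reduces multiplicativity to that of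
  \<open>h\<close>.\<close>

lemma push_mult:
  fixes f g :: "'m::monoid_add \<Rightarrow>\<^sub>0 'a::semiring_0"
  assumes "\<And>u v. h (u + v) = h u + h v"
  shows "push h (f * g) = push h f * push h g"
proof -
  have "push h (f * g) =
      push h ((\<Sum>w\<in>Poly_Mapping.keys f. Poly_Mapping.single w (Poly_Mapping.lookup f w)) *
        (\<Sum>w\<in>Poly_Mapping.keys g. Poly_Mapping.single w (Poly_Mapping.lookup g w)))"
    by (simp flip: poly_mapping_eq_sum_singles)
  also have "\<dots> = push h f * push h g"
    by (simp add: sum_product push_sum mult_single assms) (simp add: push_def sum_product mult_single)
  finally show ?thesis .
qed

section \<open>Lie polynomials have no mixed coefficients\<close>

text \<open>The target is the product monoid, whose algebra is the tensor product of the free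
  algebras on the letters in \<open>A\<close> and on those outside \<open>A\<close>.\<close>

definition split_word :: "'i set \<Rightarrow> 'i list \<Rightarrow> 'i list \<times> 'i list"
  where "split_word A w = (filter (\<lambda>i. i \<in> A) w, filter (\<lambda>i. i \<notin> A) w)"

lemma split_word_add: "split_word A (u + v) = split_word A u + split_word A v"
  by (simp add: split_word_def plus_list_def)

definition left_words :: "('i list \<times> 'i list) set"
  where "left_words = {p. snd p = []}"

definition right_words :: "('i list \<times> 'i list) set"
  where "right_words = {p. fst p = []}"

lemma keys_bracket_subset:
  fixes F G :: "('i list \<times> 'i list) \<Rightarrow>\<^sub>0 'a::field"
  assumes "Poly_Mapping.keys F \<subseteq> M" "Poly_Mapping.keys G \<subseteq> M"
    and "\<And>p q. p \<in> M \<Longrightarrow> q \<in> M \<Longrightarrow> p + q \<in> M"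
  shows "Poly_Mapping.keys (F * G - G * F) \<subseteq> M"
proof -
  have "Poly_Mapping.keys (F * G) \<subseteq> M" "Poly_Mapping.keys (G * F) \<subseteq> M"
    using keys_mult [of F G] keys_mult [of G F] assms by blast+
  then show ?thesis
    using keys_diff [of "F * G" "G * F"] by blast
qed

lemma left_right_commute:
  fixes F G :: "('i list \<times> 'i list) \<Rightarrow>\<^sub>0 'a::field"
  assumes "Poly_Mapping.keys F \<subseteq> left_words" "Poly_Mapping.keys G \<subseteq> right_words"
  shows "F * G = G * F"
proof -
  let ?s = "\<lambda>F p. Poly_Mapping.single p (Poly_Mapping.lookup F p)"
  have comm: "p + q = q + p" if "p \<in> Poly_Mapping.keys F" "q \<in> Poly_Mapping.keys G" for p q
    using assms that
    by (cases p; cases q) (auto simp: left_words_def right_words_def plus_list_def)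
  have "F * G = sum (?s F) (Poly_Mapping.keys F) * sum (?s G) (Poly_Mapping.keys G)"
    by (simp flip: poly_mapping_eq_sum_singles)
  also have "\<dots> = sum (?s G) (Poly_Mapping.keys G) * sum (?s F) (Poly_Mapping.keys F)"
    unfolding sum_product
    by (subst sum.swap) (intro sum.cong refl, simp add: mult_single comm mult.commute)
  also have "\<dots> = G * F"
    by (simp flip: poly_mapping_eq_sum_singles)
  finally show ?thesis .
qed

text \<open>Each side is closed under products, so a bracket of two elements on the same side stays
  there; on opposite sides the factors commute and the bracket is 0.\<close>

lemma keys_push_lie_word:
  assumes "f \<in> lie_words I"
  shows "Poly_Mapping.keys (push (split_word A) f) \<subseteq> left_words \<or>
    Poly_Mapping.keys (push (split_word A) f) \<subseteq> right_words"
  using assms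
proof induction
  case (letter i)
  then show ?case
    by (auto simp: letter_def split_word_def left_words_def right_words_def)
next
  case (bracket f g)
  let ?F = "push (split_word A) f" and ?G = "push (split_word A) g"
  have eq: "push (split_word A) (bracket f g) = ?F * ?G - ?G * ?F"
    by (simp add: bracket_def push_diff push_mult split_word_add)
  have add: "p + q \<in> left_words" if "p \<in> left_words" "q \<in> left_words" for p q :: "'a list \<times> 'a list"
    using that by (auto simp: left_words_def plus_list_def)
  have add': "p + q \<in> right_words" if "p \<in> right_words" "q \<in> right_words" for p q :: "'a list \<times> 'a list"
    using that by (auto simp: right_words_def plus_list_def)
  from bracket.IH show ?case
    unfolding eq
    using keys_bracket_subset [of ?F left_words ?G, OF _ _ add]
      keys_bracket_subset [of ?F right_words ?G, OF _ _ add']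
      left_right_commute [of ?F ?G] left_right_commute [of ?G ?F]
    by auto
qed

lemma lookup_push_lie_polynomial:
  assumes "lie_polynomial I f" "u \<noteq> []" "v \<noteq> []"
  shows "Poly_Mapping.lookup (push (split_word A) f) (u, v) = 0"
  using assms(1) unfolding lie_polynomial_def
proof (induction rule: free_algebra.span_induct_alt)
  case base
  then show ?case by simp
next
  case (step c x y)
  have "(u, v) \<notin> Poly_Mapping.keys (push (split_word A) x)"
    using keys_push_lie_word [OF step.hyps(1), of A] assms(2,3)
    by (auto simp: left_words_def right_words_def)
  \<comment> \<open>A scalar is supported at the empty word, which goes to the neutral pair; hence
    scaling cannot enlarge the support.\<close>
  moreover have "push (split_word A) (scale c x) = Poly_Mapping.single 0 c * push (split_word A) x"
    by (simp add: scale_def push_mult split_word_add) (simp add: split_word_def zero_prod_def zero_list_def)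
  ultimately have "(u, v) \<notin> Poly_Mapping.keys (push (split_word A) (scale c x))"
    using keys_mult [of "Poly_Mapping.single 0 c" "push (split_word A) x"]
    by (auto simp: zero_prod_def zero_list_def plus_list_def split: if_splits)
  then show ?case
    using step.IH by (simp add: push_add lookup_add in_keys_iff)
qed

section \<open>The sign of a word\<close>

text \<open>This is -1 to the number of inversions. The recursion on the first letter matches that
  of \<open>shuffles\<close>.\<close>

fun word_sign :: "'b::linorder list \<Rightarrow> int"
  where
    "word_sign [] = 1"
  | "word_sign (x # xs) = (-1) ^ length (filter (\<lambda>y. y < x) xs) * word_sign xs"

lemma word_sign_swap_adjacent:
  assumes "x \<noteq> y"
  shows "word_sign (u @ x # y # v) = - word_sign (u @ y # x # v)"
  using assms by (induction u) auto

lemma word_sign_move: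
  assumes "x \<notin> set m"
  shows "word_sign (u @ x # m @ v) = (-1) ^ length m * word_sign (u @ m @ x # v)"
  using assms
proof (induction m arbitrary: u)
  case (Cons y m)
  then show ?case
    using word_sign_swap_adjacent [of x y u "m @ v"] Cons.IH [of "u @ [y]"] by simp
qed simp

text \<open>Moving \<open>x\<close> right across \<open>m\<close>, past \<open>y\<close>, and then
  \<open>y\<close> left across \<open>m\<close> takes \<open>2 * length m + 1\<close> adjacent
  swaps, an odd number.\<close>

lemma word_sign_swap:
  assumes "distinct (u @ x # m @ y # v)"
  shows "word_sign (u @ y # m @ x # v) = - word_sign (u @ x # m @ y # v)"
proof -
  have "word_sign (u @ x # m @ y # v) = (-1) ^ length m * word_sign (u @ m @ x # y # v)"
    using assms by (intro word_sign_move) auto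
  also have "word_sign (u @ m @ x # y # v) = - word_sign (u @ m @ y # x # v)"
    using assms word_sign_swap_adjacent [of x y "u @ m" v] by auto
  finally show ?thesis
    using assms word_sign_move [of y m u "x # v"] by simp
qed

text \<open>Without repetitions, renaming by a transposition exchanges two positions. The auxiliary
  claim treats \<open>a\<close> before \<open>b\<close>; the other order follows by
  symmetry.\<close>

lemma word_sign_transpose:
  assumes "distinct w" "a \<in> set w" "b \<in> set w" "a \<noteq> b"
  shows "word_sign (map (transpose a b) w) = - word_sign w"
proof -
  have *: "word_sign (map (transpose a b) w) = - word_sign w"
    if "w = u @ a # m @ b # v" "distinct w" for a b u m v
  proof -
    have "map (transpose a b) z = z" if "a \<notin> set z" "b \<notin> set z" for z
      using that by (auto intro!: map_idI transpose_apply_other)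
    then have "map (transpose a b) w = u @ b # m @ a # v"
      using that by simp
    then show ?thesis
      using that word_sign_swap [of u a m b v] by simp
  qed
  from assms(2) obtain u v where w: "w = u @ a # v"
    by (meson split_list)
  with assms consider "b \<in> set u" | "b \<in> set v"
    by auto
  then show ?thesis
  proof cases
    case 1
    then obtain u1 u2 where "u = u1 @ b # u2"
      by (meson split_list)
    then show ?thesis
      using * [of u1 b u2 a v] assms w by (simp add: transpose_commute)
  next
    case 2
    then obtain v1 v2 where "v = v1 @ b # v2"
      by (meson split_list)
    then show ?thesis
      using * [of u a v1 b v2] assms w by simp
  qed
qed

lemma word_sign_sorted: "sorted w \<Longrightarrow> word_sign w = 1"
proof (induction w)
  case (Cons x w)
  then have "filter (\<lambda>y. y < x) w = []"
    by (auto simp: filter_empty_conv)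
  with Cons show ?case by simp
qed simp

text \<open>Both sides are 1 at the identity and change sign under composition with a transposition
  on the left.\<close>

lemma word_sign_permutes:
  fixes xs :: "nat list"
  assumes "\<pi> permutes set xs" "sorted xs" "distinct xs"
  shows "word_sign (map \<pi> xs) = sign \<pi>"
  using assms(1) finite_set [of xs]
proof (induction rule: permutes_induct)
  case id
  then show ?case by (simp add: word_sign_sorted assms)
next
  case (swap a b p)
  have "distinct (map p xs)"
    using swap assms by (simp add: distinct_map permutes_inj_on)
  moreover have "set (map p xs) = set xs"
    using swap by (simp add: permutes_image)
  ultimately have "word_sign (map (transpose a b) (map p xs)) = - word_sign (map p xs)"
    using swap by (intro word_sign_transpose) auto
  moreover have "sign (transpose a b \<circ> p) = - sign p"
    using swap by (subst sign_compose)
      (auto simp: sign_swap_id permutation_swap_id intro: permutes_imp_permutation [OF finite_set])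
  ultimately show ?case
    using swap by (simp add: comp_def)
qed

section \<open>The signed number of shuffles\<close>

text \<open>The Gaussian binomial coefficient of \<open>a + b\<close> over \<open>a\<close> at \<open>q = -1\<close>.\<close>

definition gauss_binomial :: "nat \<Rightarrow> nat \<Rightarrow> int"
  where "gauss_binomial a b =
    (if odd a \<and> odd b then 0 else of_nat ((a div 2 + b div 2) choose (a div 2)))"

lemma gauss_binomial_0 [simp]: "gauss_binomial 0 b = 1" "gauss_binomial a 0 = 1"
  by (simp_all add: gauss_binomial_def)

text \<open>The q-Pascal rule at \<open>q = -1\<close>. For \<open>a\<close> and \<open>b\<close>
  odd it is the ordinary Pascal rule; for other parities two equal terms cancel or one term
  vanishes.\<close>

lemma gauss_binomial_Suc_Suc:
  "gauss_binomial (Suc a) (Suc b) = gauss_binomial a (Suc b) + (-1) ^ Suc a * gauss_binomial (Suc a) b"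
proof (cases "even a"; cases "even b")
  assume "odd a" "odd b"
  then obtain a' b' where "a = Suc (2 * a')" "b = Suc (2 * b')"
    by (metis oddE Suc_eq_plus1)
  then show ?thesis
    by (simp add: gauss_binomial_def)
qed (auto simp: gauss_binomial_def elim!: evenE oddE)

text \<open>Split by the first letter. A leading \<open>x\<close> is the least letter and creates no
  inversion; a leading \<open>y\<close> exceeds exactly the letters of \<open>x # xs\<close>. This
  gives the q-Pascal recursion.\<close>

lemma sum_word_sign_shuffles:
  fixes xs ys :: "'b::linorder list"
  assumes "sorted (xs @ ys)" "distinct (xs @ ys)"
  shows "(\<Sum>w\<in>shuffles xs ys. word_sign w) = gauss_binomial (length xs) (length ys)"
  using assms
proof (induction xs ys rule: shuffles.induct)
  case (1 ys)
  then show ?case by (simp add: word_sign_sorted)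
next
  case (2 xs)
  then show ?case by (simp add: word_sign_sorted del: word_sign.simps)
next
  case (3 x xs y ys)
  have less: "z < y" if "z \<in> set (x # xs)" for z
    using "3.prems" that by (auto simp: sorted_append order.strict_iff_order)
  have x: "word_sign (x # w) = word_sign w" if "w \<in> shuffles xs (y # ys)" for w
  proof -
    have "set w = set xs \<union> set (y # ys)"
      using that by (rule set_shuffles)
    then have "filter (\<lambda>z. z < x) w = []"
      using "3.prems" by (auto simp: filter_empty_conv sorted_append not_less)
    then show ?thesis by simp
  qed
  have y: "word_sign (y # w) = (-1) ^ Suc (length xs) * word_sign w"
    if "w \<in> shuffles (x # xs) ys" for w
  proof -
    have "filter (\<lambda>z. z < y) (x # xs) = x # xs" "filter (\<lambda>z. z < y) ys = []"
      using less "3.prems" by (auto intro!: filter_True simp: filter_empty_conv sorted_append leD)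
    then have "filter (\<lambda>z. z < y) w = x # xs"
      using filter_shuffles [of "\<lambda>z. z < y" "x # xs" ys] that by auto
    then show ?thesis by simp
  qed
  have "(\<Sum>w\<in>shuffles (x # xs) (y # ys). word_sign w) =
      (\<Sum>w\<in>shuffles xs (y # ys). word_sign (x # w)) + (\<Sum>w\<in>shuffles (x # xs) ys. word_sign (y # w))"
    using less by (subst shuffles.simps, subst sum.union_disjoint)
      (auto simp: sum.reindex simp del: word_sign.simps)
  also have "\<dots> = (\<Sum>w\<in>shuffles xs (y # ys). word_sign w) +
      (-1) ^ Suc (length xs) * (\<Sum>w\<in>shuffles (x # xs) ys. word_sign w)"
    by (simp add: x y sum_distrib_left del: word_sign.simps)
  also have "\<dots> = gauss_binomial (length (x # xs)) (length (y # ys))"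
    using "3.IH" "3.prems" by (simp add: gauss_binomial_Suc_Suc sorted_append)
  finally show ?case .
qed

section \<open>Mixed coefficients of the standard polynomial\<close>

lemma prod_list_letter:
  "(\<Prod>j\<leftarrow>xs. letter (f j)) = (Poly_Mapping.single (map f xs) 1 :: ('i, 'a::field) free_algebra)"
proof (induction xs)
  case Nil
  then show ?case by simp (metis single_one zero_list_def)
next
  case (Cons x xs)
  then show ?case by (simp add: letter_def mult_single plus_list_def)
qed

lemma standard_polynomial_eq:
  "(standard_polynomial \<iota> k :: ('i, 'a::field) free_algebra) =
    (\<Sum>\<pi> | \<pi> permutes {1..k}. Poly_Mapping.single (map \<iota> (map \<pi> [1..<Suc k])) (of_int (sign \<pi>)))"
  unfolding standard_polynomial_def
  by (intro sum.cong refl)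
    (simp only: prod_list_letter scale_def mult_single plus_list_def append_Nil mult_1_right map_map comp_def)

lemma bij_betw_permutes_lists:
  assumes "distinct xs"
  shows "bij_betw (\<lambda>\<pi>. map \<pi> xs) {\<pi>. \<pi> permutes set xs} {w. distinct w \<and> set w = set xs}"
proof (rule bij_betw_imageI)
  show "inj_on (\<lambda>\<pi>. map \<pi> xs) {\<pi>. \<pi> permutes set xs}"
  proof (rule inj_onI)
    fix \<pi> \<rho> assume *: "\<pi> \<in> {\<pi>. \<pi> permutes set xs}" "\<rho> \<in> {\<pi>. \<pi> permutes set xs}" "map \<pi> xs = map \<rho> xs"
    show "\<pi> = \<rho>"
    proof
      fix x show "\<pi> x = \<rho> x"
        using * by (cases "x \<in> set xs") (auto simp: permutes_not_in)
    qed
  qed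
  show "(\<lambda>\<pi>. map \<pi> xs) ` {\<pi>. \<pi> permutes set xs} = {w. distinct w \<and> set w = set xs}"
  proof (intro equalityI subsetI)
    fix w assume "w \<in> (\<lambda>\<pi>. map \<pi> xs) ` {\<pi>. \<pi> permutes set xs}"
    then obtain \<pi> where "\<pi> permutes set xs" "w = map \<pi> xs"
      by blast
    then show "w \<in> {w. distinct w \<and> set w = set xs}"
      using assms by (simp add: distinct_map permutes_inj_on permutes_image)
  next
    fix w assume w: "w \<in> {w. distinct w \<and> set w = set xs}"
    with assms have len: "length xs = length w"
      by (metis (mono_tags, lifting) distinct_card mem_Collect_eq)
    \<comment> \<open>It sends each entry of \<open>xs\<close> to the entry of \<open>w\<close> at
      the same position and fixes everything else.\<close>
    let ?\<pi> = "permutation_of_list (zip xs w)"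
    have "?\<pi> permutes set xs"
      using w assms len by (intro permutation_of_list_permutes) (simp add: list_permutes_def)
    moreover have "map ?\<pi> xs = w"
    proof (rule nth_equalityI)
      fix i assume "i < length (map ?\<pi> xs)"
      then show "map ?\<pi> xs ! i = w ! i"
        using assms len by (simp add: permutation_of_list_def map_of_zip_nth)
    qed (use len in simp)
    ultimately show "w \<in> (\<lambda>\<pi>. map \<pi> xs) ` {\<pi>. \<pi> permutes set xs}"
      by (intro image_eqI [of _ _ ?\<pi>]) simp_all
  qed
qed

lemma lookup_push_standard_polynomial:
  assumes "inj_on \<iota> {1..k}" "j \<le> k"
  defines "u \<equiv> [1..<Suc j]" and "v \<equiv> [Suc j..<Suc k]"
  shows "Poly_Mapping.lookup (push (split_word (\<iota> ` {1..j}))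
      (standard_polynomial \<iota> k :: ('i, 'a::field) free_algebra)) (map \<iota> u, map \<iota> v) =
    of_int (gauss_binomial j (k - j))"
proof -
  let ?xs = "[1..<Suc k]" and ?W = "{w. distinct w \<and> set w = {1..k}}"
  let ?split = "\<lambda>w. split_word (\<iota> ` {1..j}) (map \<iota> w) = (map \<iota> u, map \<iota> v)"
  have xs: "set ?xs = {1..k}"
    by auto
  have uv: "set u = {1..j}" "set v = {Suc j..k}"
    by (auto simp: u_def v_def)
  \<comment> \<open>Injectivity of \<open>\<iota>\<close> brings the splitting back to numbers,
    where it is a \<open>partition\<close>; the words with given parts \<open>u\<close> and
    \<open>v\<close> are their shuffles.\<close>
  have split_iff: "?split w \<longleftrightarrow> w \<in> shuffles u v" if "set w = {1..k}" for w
  proof -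
    have "\<iota> i \<in> \<iota> ` {1..j} \<longleftrightarrow> i \<in> {1..j}" if "i \<in> set w" for i
      using that \<open>set w = {1..k}\<close> assms(2) by (intro inj_on_image_mem_iff [OF assms(1)]) auto
    then have "split_word (\<iota> ` {1..j}) (map \<iota> w) =
        (map \<iota> (filter (\<lambda>i. i \<in> {1..j}) w), map \<iota> (filter (\<lambda>i. i \<notin> {1..j}) w))"
      by (simp add: split_word_def filter_map comp_def cong: filter_cong)
    moreover have "inj_on (map \<iota>) {z. set z \<subseteq> {1..k}}"
      using assms(1) by (simp add: inj_on_map_lists lists_eq_set [symmetric])
    then have map_eq: "map \<iota> y = map \<iota> z \<longleftrightarrow> y = z" if "set y \<subseteq> {1..k}" "set z \<subseteq> {1..k}" for y z
      using that by (auto dest: inj_onD)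
    have "map \<iota> (filter P w) = map \<iota> u \<longleftrightarrow> filter P w = u"
        "map \<iota> (filter P w) = map \<iota> v \<longleftrightarrow> filter P w = v" for P
      using that uv assms(2) by (intro map_eq; auto)+
    ultimately have "?split w \<longleftrightarrow> partition (\<lambda>i. i \<in> {1..j}) w = (u, v)"
      by (simp add: comp_def)
    also have "\<dots> \<longleftrightarrow> w \<in> shuffles u v"
      using inv_image_partition [of u "\<lambda>i. i \<in> {1..j}" v] uv by auto
    finally show ?thesis .
  qed
  have shuffles: "shuffles u v \<subseteq> ?W"
  proof
    fix w assume w: "w \<in> shuffles u v"
    have "set w = {1..k}"
      using set_shuffles [OF w] uv assms(2) by auto
    moreover have "distinct w"
      by (rule distinct_disjoint_shuffles [OF _ _ _ w]) (auto simp: u_def v_def simp del: upt_Suc)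
    ultimately show "w \<in> ?W" by simp
  qed
  have "?W \<subseteq> {w. set w \<subseteq> {1..k} \<and> length w \<le> k}"
    by (auto dest!: distinct_card)
  then have fin: "finite ?W"
    using finite_lists_length_le [of "{1..k}" k] finite_subset by blast
  have "Poly_Mapping.lookup (push (split_word (\<iota> ` {1..j}))
      (standard_polynomial \<iota> k :: ('i, 'a) free_algebra)) (map \<iota> u, map \<iota> v) =
    (\<Sum>\<pi> | \<pi> permutes {1..k}. if ?split (map \<pi> ?xs) then of_int (sign \<pi>) else 0)"
    by (simp add: standard_polynomial_eq push_sum lookup_sum lookup_single when_def del: upt_Suc)
  \<comment> \<open>Once the sign depends only on the word \<open>map \<pi> ?xs\<close>, the sum can
    be reindexed by words.\<close>
  also have "\<dots> = (\<Sum>\<pi> | \<pi> permutes set ?xs. if ?split (map \<pi> ?xs) then of_int (word_sign (map \<pi> ?xs)) else 0)"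
    unfolding xs [symmetric] by (intro sum.cong refl) (simp add: word_sign_permutes del: upt_Suc set_upt)
  also have "\<dots> = (\<Sum>w\<in>?W. if ?split w then of_int (word_sign w) else 0)"
    unfolding xs [symmetric] by (rule sum.reindex_bij_betw [OF bij_betw_permutes_lists]) simp
  also have "\<dots> = (\<Sum>w\<in>shuffles u v. of_int (word_sign w))"
    using shuffles fin by (intro sum.mono_neutral_cong_right) (auto simp: split_iff simp del: One_nat_def)
  also have "\<dots> = of_int (\<Sum>w\<in>shuffles u v. word_sign w)"
    by simp
  also have "(\<Sum>w\<in>shuffles u v. word_sign w) = gauss_binomial j (k - j)"
    by (subst sum_word_sign_shuffles) (auto simp: u_def v_def sorted_append simp del: upt_Suc)
  finally show ?thesis .
qed

section \<open>Nonvanishing of a binomial coefficient\<close>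

text \<open>As 0 divides only 0, for \<open>p\<close> the characteristic the conclusion says in all
  cases that the binomial coefficient is nonzero in the field.\<close>

lemma binomial_not_dvd:
  fixes n p :: nat
  assumes "n > 1" "prime p \<or> p = 0" "\<And>m. n \<noteq> p ^ m"
  shows "\<exists>i. 0 < i \<and> i < n \<and> \<not> p dvd (n choose i)"
proof (cases "p = 0")
  case True
  then show ?thesis
    using assms(1) by (intro exI [of _ 1]) simp
next
  case False
  with assms have p: "prime p" by simp
  define m where "m = multiplicity p n"
  obtain q where q: "n = p ^ m * q" "\<not> p dvd q"
    unfolding m_def using assms(1) p multiplicity_decompose' [of n p] by (metis not_one_less_zero not_prime_unit)
  \<comment> \<open>\<open>q = 0\<close> would give \<open>n = 0\<close>, and \<open>q = 1\<close>
    would make \<open>n\<close> a power of \<open>p\<close>. Thus \<open>p ^ m < n\<close>.\<close>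
  have "q > 1"
    using q assms(1,3) by (cases q; cases "q - 1") auto
  have "n choose p ^ m > 0"
    using q \<open>q > 1\<close> by (simp add: zero_less_binomial_iff)
  \<comment> \<open>By \<open>const_p_fac\<close> this multiplicity equals that of \<open>p\<close>
    in \<open>q\<close>.\<close>
  moreover have "multiplicity p (n choose p ^ m) = 0"
    using q p \<open>q > 1\<close> by (simp add: const_p_fac not_dvd_imp_multiplicity_0)
  ultimately have "\<not> p dvd (n choose p ^ m)"
    using p by (metis multiplicity_eq_zero_iff not_gr_zero not_prime_unit)
  then show ?thesis
    using q \<open>q > 1\<close> p by (intro exI [of _ "p ^ m"]) (auto simp: prime_gt_0_nat)
qed

theorem theorem1:
  fixes I :: "'i set" and \<iota> :: "nat \<Rightarrow> 'i" and k :: nat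
  assumes "inj_on \<iota> {1..k}" and "\<iota> ` {1..k} \<subseteq> I"
    and "k > 2"
    and "\<And>m. k \<noteq> 2 * CHAR('a::field) ^ m"
  shows "\<not> lie_polynomial I (standard_polynomial \<iota> k :: ('i, 'a) free_algebra)"
proof
  assume lie: "lie_polynomial I (standard_polynomial \<iota> k :: ('i, 'a) free_algebra)"
  \<comment> \<open>The bounds on \<open>j\<close> make both words of the pair nonempty, so this
    coefficient is mixed.\<close>
  have zero: "of_int (gauss_binomial j (k - j)) = (0::'a)" if "0 < j" "j < k" for j
    using lookup_push_standard_polynomial [OF assms(1), of j, where ?'a = 'a]
      lookup_push_lie_polynomial [OF lie] that by simp
  show False
  proof (cases "even k")
    case True
    then obtain n where n: "k = 2 * n" by (elim evenE)
    \<comment> \<open>Here \<open>k > 2\<close> gives \<open>n > 1\<close>, and the excluded degrees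
      say that \<open>n\<close> is not a power of the characteristic.\<close>
    then obtain i where i: "0 < i" "i < n" "\<not> CHAR('a) dvd (n choose i)"
      using binomial_not_dvd [of n "CHAR('a)"] assms(3,4) prime_CHAR_semidom [where ?'a = 'a] by auto
    have "gauss_binomial (2 * i) (k - 2 * i) = int (n choose i)"
      using n i by (simp add: gauss_binomial_def flip: right_diff_distrib')
    then show False
      using zero [of "2 * i"] n i by (simp add: of_nat_eq_0_iff_char_dvd)
  next
    case False
    then have "gauss_binomial 1 (k - 1) = 1"
      using assms(3) by (simp add: gauss_binomial_def)
    then show False
      using zero [of 1] assms(3) by simp
  qed
qed

end
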